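(* Let $a,b_1,b_2\ge1$ be integers. If $P_{a,b_1}\neq\emptyset$ and $P_{a,b_2}\neq\emptyset$, then $P_{a,b_1+b_2}\neq\emptyset$. Likewise, for integers $a_1,a_2,b\ge1$, if $P_{a_1,b}\neq\emptyset$ and $P_{a_2,b}\neq\emptyset$, then $P_{a_1+a_2,b}\neq\emptyset$.
   Context: $\mathbb{T}^m=\mathbb{R}^m/2\pi\mathbb{Z}^m$ with its flat coordinates. A $C^\infty$ map $h:\mathbb{T}^a\times\mathbb{T}^b\to\mathbb{R}^{ab}$, $(x,y)\mapsto h(x,y)$, is cross-free if its mixed Hessian, the linear map $H_h(x,y):\mathbb{R}^a\otimes\mathbb{R}^b\to\mathbb{R}^{ab}$, $e_i\otimes e_\alpha\mapsto\frac{\partial^2h}{\partial x^i\partial y^\alpha}(x,y)$, is invertible at every point $(x,y)$. $P_{a,b}$ denotes the set of all cross-free maps on $\mathbb{T}^a\times\mathbb{T}^b$. *)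

theory Defs
  imports "HOL-Analysis.Analysis"
begin

definition torus_rel :: "real ^ 'm \<Rightarrow> real ^ 'm \<Rightarrow> bool" where
  "torus_rel x y \<longleftrightarrow> (\<forall>i. \<exists>k::int. x $ i - y $ i = 2 * pi * of_int k)"

lemma equivp_torus_rel: "equivp torus_rel"
proof (rule equivpI)
  show "reflp torus_rel"
    by (auto simp: reflp_def torus_rel_def intro!: exI[of _ 0])
  show "symp torus_rel"
    unfolding symp_def torus_rel_def
  proof (intro allI impI)
    fix x y :: "real ^ 'm" and i
    assume "\<forall>i. \<exists>k::int. x $ i - y $ i = 2 * pi * of_int k"
    then obtain k :: int where "x $ i - y $ i = 2 * pi * of_int k" by blast
    then have "y $ i - x $ i = 2 * pi * of_int (- k)" by simp
    then show "\<exists>k::int. y $ i - x $ i = 2 * pi * of_int k" by blast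
  qed
  show "transp torus_rel"
    unfolding transp_def torus_rel_def
  proof (intro allI impI)
    fix x y z :: "real ^ 'm" and i
    assume "\<forall>i. \<exists>k::int. x $ i - y $ i = 2 * pi * of_int k"
      and "\<forall>i. \<exists>k::int. y $ i - z $ i = 2 * pi * of_int k"
    then obtain k l :: int where "x $ i - y $ i = 2 * pi * of_int k"
      "y $ i - z $ i = 2 * pi * of_int l" by blast
    then have "x $ i - z $ i = 2 * pi * of_int (k + l)" by (simp add: distrib_left)
    then show "\<exists>k::int. x $ i - z $ i = 2 * pi * of_int k" by blast
  qed
qed

text \<open>The torus of dimension \<open>CARD('m)\<close>; \<open>abs_torus\<close> is the quotient map.\<close>

quotient_type 'm torus = "real ^ 'm::finite" / torus_rel
  by (rule equivp_torus_rel)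

definition dir_deriv ::
  "'v::real_normed_vector \<Rightarrow> ('v \<Rightarrow> 'w::real_normed_vector) \<Rightarrow> 'v \<Rightarrow> 'w" where
  "dir_deriv w f = (\<lambda>p. frechet_derivative f (at p) w)"

primrec C_k :: "nat \<Rightarrow> ('v::real_normed_vector \<Rightarrow> 'w::real_normed_vector) \<Rightarrow> bool" where
  "C_k 0 f \<longleftrightarrow> continuous_on UNIV f"
| "C_k (Suc k) f \<longleftrightarrow> (\<forall>p. f differentiable (at p)) \<and> (\<forall>w. C_k k (dir_deriv w f))"

definition C_infinity :: "('v::real_normed_vector \<Rightarrow> 'w::real_normed_vector) \<Rightarrow> bool" where
  "C_infinity f \<longleftrightarrow> (\<forall>k. C_k k f)"

text \<open>A map on a product of two tori, expressed in the flat coordinates. Since the quotient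
  map is a local diffeomorphism, smoothness and derivatives on the torus are those of the lift.\<close>

definition lift ::
  "('a::finite torus \<times> 'b::finite torus \<Rightarrow> 'w) \<Rightarrow> (real ^ 'a) \<times> (real ^ 'b) \<Rightarrow> 'w" where
  "lift h = (\<lambda>(x, y). h (abs_torus x, abs_torus y))"

definition mixed_partial ::
  "('a::finite torus \<times> 'b::finite torus \<Rightarrow> 'w::real_normed_vector)
    \<Rightarrow> 'a \<Rightarrow> 'b \<Rightarrow> (real ^ 'a) \<times> (real ^ 'b) \<Rightarrow> 'w" where
  "mixed_partial h i \<alpha> = dir_deriv (axis i 1, 0) (dir_deriv (0, axis \<alpha> 1) (lift h))"

text \<open>The tensor product of \<open>real ^ 'a\<close> and \<open>real ^ 'b\<close> is taken to be \<open>real ^ ('a \<times> 'b)\<close>,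
  where the tensor of the basis vectors with indices \<open>i\<close> and \<open>\<alpha>\<close> is \<open>axis (i, \<alpha>) 1\<close>.\<close>

definition mixed_hessian ::
  "('a::finite torus \<times> 'b::finite torus \<Rightarrow> 'w::real_normed_vector)
    \<Rightarrow> (real ^ 'a) \<times> (real ^ 'b) \<Rightarrow> real ^ ('a \<times> 'b) \<Rightarrow> 'w" where
  "mixed_hessian h p = (\<lambda>z. \<Sum>(i, \<alpha>)\<in>UNIV. z $ (i, \<alpha>) *\<^sub>R mixed_partial h i \<alpha> p)"

lemma linear_mixed_hessian: "linear (mixed_hessian h p)"
  by (rule linearI)
    (auto simp: mixed_hessian_def scaleR_add_left sum.distrib scaleR_sum_right case_prod_unfold)

lemma mixed_hessian_axis: "mixed_hessian h p (axis (i, \<alpha>) 1) = mixed_partial h i \<alpha> p"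
proof -
  have "mixed_hessian h p (axis (i, \<alpha>) 1) =
      (\<Sum>q\<in>UNIV. if q = (i, \<alpha>) then mixed_partial h i \<alpha> p else 0)"
    unfolding mixed_hessian_def by (rule sum.cong) (auto simp: axis_def split: if_splits)
  then show ?thesis by simp
qed

definition cross_free ::
  "('a::finite torus \<times> 'b::finite torus \<Rightarrow> real ^ ('a \<times> 'b)) \<Rightarrow> bool" where
  "cross_free h \<longleftrightarrow> C_infinity (lift h) \<and> (\<forall>p. bij (mixed_hessian h p))"

definition cross_free_maps ::
  "'a::finite itself \<Rightarrow> 'b::finite itself \<Rightarrow> ('a torus \<times> 'b torus \<Rightarrow> real ^ ('a \<times> 'b)) set" where
  "cross_free_maps _ _ = {h. cross_free h}"

end

theory Submission imports Defs begin

text \<open>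
  Cross-free maps can be placed side by side. Split the coordinates of
  \<open>\<real>\<^sup>b = \<real>\<^sup>b\<^sup>1 \<times> \<real>\<^sup>b\<^sup>2\<close>, so that \<open>y = (y\<^sub>1, y\<^sub>2)\<close>, and put
  \<open>h(x, y) = (h\<^sub>1(x, y\<^sub>1), h\<^sub>2(x, y\<^sub>2))\<close>. A derivative in a direction of the first block kills the
  second component and vice versa, so the mixed Hessian of \<open>h\<close> is block diagonal with the
  invertible mixed Hessians of \<open>h\<^sub>1\<close> and \<open>h\<^sub>2\<close> as blocks.

  The two halves of the theorem are the same statement about index sets. All that matters is
  that the index set of the entries of the big Hessian is the disjoint union of two rectangles
  \<open>u\<^sub>1(A\<^sub>1) \<times> v\<^sub>1(B\<^sub>1)\<close> and \<open>u\<^sub>2(A\<^sub>2) \<times> v\<^sub>2(B\<^sub>2)\<close>, where the \<open>u\<^sub>k\<close> and \<open>v\<^sub>k\<close> are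
  injections of index sets. Splitting the second torus factor is the case \<open>u\<^sub>1 = u\<^sub>2 = id\<close>, and
  splitting the first is the case \<open>v\<^sub>1 = v\<^sub>2 = id\<close>. In this form the construction is
  \<open>cross_free_direct_sum\<close>; the block structure is \<open>mixed_hessian_direct_sum\<close>, and
  smoothness is \<open>C_infinity_linear_sandwich_add\<close>, which holds because \<open>h\<close> is a
  sum of two terms, each a smooth map composed with linear maps on both sides.
\<close>

section \<open>Restricting and extending coordinate vectors\<close>

definition restrict_coords :: "('c::finite \<Rightarrow> 'd::finite) \<Rightarrow> real ^ 'd \<Rightarrow> real ^ 'c" where
  "restrict_coords u x = (\<chi> c. x $ u c)"

definition extend_by_zero :: "('c::finite \<Rightarrow> 'd::finite) \<Rightarrow> real ^ 'c \<Rightarrow> real ^ 'd" where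
  "extend_by_zero u z = (\<chi> d. if d \<in> range u then z $ inv u d else 0)"

definition restrict_pair ::
  "('a1::finite \<Rightarrow> 'a::finite) \<Rightarrow> ('b1::finite \<Rightarrow> 'b::finite)
    \<Rightarrow> (real ^ 'a) \<times> (real ^ 'b) \<Rightarrow> (real ^ 'a1) \<times> (real ^ 'b1)" where
  "restrict_pair u v p = (restrict_coords u (fst p), restrict_coords v (snd p))"

lift_definition torus_restrict :: "('c::finite \<Rightarrow> 'd::finite) \<Rightarrow> 'd torus \<Rightarrow> 'c torus"
  is restrict_coords
  by (simp add: torus_rel_def restrict_coords_def)

lemma linear_restrict_coords: "linear (restrict_coords u)"
  by (rule linearI) (simp_all add: restrict_coords_def vec_eq_iff)

lemma linear_extend_by_zero: "linear (extend_by_zero u)"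
  by (rule linearI) (simp_all add: extend_by_zero_def vec_eq_iff)

lemma linear_restrict_pair: "linear (restrict_pair u v)"
  by (rule linearI)
    (simp_all add: restrict_pair_def linear_add[OF linear_restrict_coords]
      linear_cmul[OF linear_restrict_coords])

lemma restrict_coords_extend_by_zero:
  "inj u \<Longrightarrow> restrict_coords u (extend_by_zero u z) = z"
  by (simp add: restrict_coords_def extend_by_zero_def vec_eq_iff)

lemma restrict_coords_extend_by_zero_disjoint:
  assumes "range u \<inter> range v = {}"
  shows "restrict_coords u (extend_by_zero v z) = 0"
  using assms by (auto simp: restrict_coords_def extend_by_zero_def vec_eq_iff)

lemma extend_restrict_decomposition:
  assumes "inj u" "inj v" "range u \<inter> range v = {}" "range u \<union> range v = UNIV"
  shows "extend_by_zero u (restrict_coords u z) + extend_by_zero v (restrict_coords v z) = z"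
  unfolding vec_eq_iff
proof
  fix d
  have "d \<in> range u \<or> d \<in> range v"
    using assms(4) by blast
  then show "(extend_by_zero u (restrict_coords u z) + extend_by_zero v (restrict_coords v z)) $ d
      = z $ d"
    using assms(3) by (auto simp: restrict_coords_def extend_by_zero_def f_inv_into_f
      inv_f_f[OF assms(1)] inv_f_f[OF assms(2)])
qed

lemma restrict_coords_axis: "inj u \<Longrightarrow> restrict_coords u (axis (u c) r) = axis c r"
  by (auto simp: restrict_coords_def axis_def vec_eq_iff inj_eq)

lemma restrict_coords_axis_outside: "d \<notin> range u \<Longrightarrow> restrict_coords u (axis d r) = 0"
  by (auto simp: restrict_coords_def axis_def vec_eq_iff)

lemma restrict_coords_zero: "restrict_coords u 0 = 0"
  by (rule linear_0[OF linear_restrict_coords])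

text \<open>Inverting the two blocks separately gives the inverse, because block diagonal maps for a
  fixed splitting of the coordinates compose blockwise.\<close>

lemma bij_block_diagonal:
  fixes u :: "'c::finite \<Rightarrow> 'e::finite" and v :: "'d::finite \<Rightarrow> 'e"
  assumes uv: "inj u" "inj v" "range u \<inter> range v = {}" "range u \<union> range v = UNIV"
    and FG: "bij F" "bij G"
  shows "bij (\<lambda>z. extend_by_zero u (F (restrict_coords u z))
                + extend_by_zero v (G (restrict_coords v z)))"
    (is "bij (?block F G)")
proof (rule o_bij)
  have swapped: "range v \<inter> range u = {}"
    using uv(3) by blast
  have compose: "?block F G (?block F' G' z) = ?block (F \<circ> F') (G \<circ> G') z" for F G F' G' z
    by (simp add: linear_add[OF linear_restrict_coords] restrict_coords_extend_by_zero uv(1,2)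
        restrict_coords_extend_by_zero_disjoint uv(3) swapped)
  have inverses: "F \<circ> inv F = id" "inv F \<circ> F = id" "G \<circ> inv G = id" "inv G \<circ> G = id"
    using FG by (auto simp: fun_eq_iff bij_is_inj bij_is_surj surj_f_inv_f)
  show "?block (inv F) (inv G) \<circ> ?block F G = id" "?block F G \<circ> ?block (inv F) (inv G) = id"
    using extend_restrict_decomposition[OF uv]
    by (simp_all add: fun_eq_iff compose inverses)
qed

section \<open>Directional derivatives and linear maps\<close>

lemma dir_deriv_zero_direction:
  assumes "\<And>p. f differentiable (at p)"
  shows "dir_deriv 0 f = (\<lambda>_. 0)"
  using linear_0[OF linear_frechet_derivative[OF assms]] by (simp add: dir_deriv_def fun_eq_iff)

lemma dir_deriv_constant: "dir_deriv w (\<lambda>_. c) = (\<lambda>_. 0)"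
  by (simp add: dir_deriv_def fun_eq_iff)

lemma has_derivative_linear_sandwich_add:
  fixes M :: "'v::euclidean_space \<Rightarrow> 'v1::real_normed_vector"
    and N :: "'v \<Rightarrow> 'v2::real_normed_vector"
    and L :: "'w1::euclidean_space \<Rightarrow> 'w::real_normed_vector"
    and K :: "'w2::euclidean_space \<Rightarrow> 'w"
  assumes lin: "linear L" "linear M" "linear K" "linear N"
    and "\<And>p. f differentiable (at p)" "\<And>p. g differentiable (at p)"
  shows "((\<lambda>p. L (f (M p)) + K (g (N p))) has_derivative
      (\<lambda>w. L (frechet_derivative f (at (M p)) (M w)) + K (frechet_derivative g (at (N p)) (N w))))
      (at p)"
proof -
  have linear_map: "(T has_derivative T) F"
    if "linear T" for T :: "'s::euclidean_space \<Rightarrow> 't::real_normed_vector" and F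
    using that by (simp add: linear_conv_bounded_linear bounded_linear_imp_has_derivative)
  have f: "(f has_derivative frechet_derivative f (at (M p))) (at (M p))"
    and g: "(g has_derivative frechet_derivative g (at (N p))) (at (N p))"
    using assms(5,6) by (simp_all add: frechet_derivative_works[symmetric])
  show ?thesis
    by (intro has_derivative_add
        has_derivative_compose[OF has_derivative_compose[OF linear_map[OF lin(2)] f] linear_map[OF lin(1)]]
        has_derivative_compose[OF has_derivative_compose[OF linear_map[OF lin(4)] g] linear_map[OF lin(3)]])
qed

lemma dir_deriv_linear_sandwich_add:
  fixes M :: "'v::euclidean_space \<Rightarrow> 'v1::real_normed_vector"
    and N :: "'v \<Rightarrow> 'v2::real_normed_vector"
    and L :: "'w1::euclidean_space \<Rightarrow> 'w::real_normed_vector"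
    and K :: "'w2::euclidean_space \<Rightarrow> 'w"
  assumes "linear L" "linear M" "linear K" "linear N"
    and "\<And>p. f differentiable (at p)" "\<And>p. g differentiable (at p)"
  shows "dir_deriv w (\<lambda>p. L (f (M p)) + K (g (N p)))
    = (\<lambda>p. L (dir_deriv (M w) f (M p)) + K (dir_deriv (N w) g (N p)))"
  unfolding dir_deriv_def
  using frechet_derivative_at[OF has_derivative_linear_sandwich_add[OF assms]]
  by (metis (no_types, lifting))

text \<open>The class of maps \<open>L \<circ> f \<circ> M + K \<circ> g \<circ> N\<close> with linear \<open>L\<close>, \<open>M\<close>, \<open>K\<close>, \<open>N\<close> is stable
  under directional derivatives, which only replace \<open>f\<close> and \<open>g\<close> by their own derivatives; so
  the order of smoothness is inherited by induction.\<close>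

lemma C_k_linear_sandwich_add:
  fixes M :: "'v::euclidean_space \<Rightarrow> 'v1::real_normed_vector"
    and N :: "'v \<Rightarrow> 'v2::real_normed_vector"
    and L :: "'w1::euclidean_space \<Rightarrow> 'w::real_normed_vector"
    and K :: "'w2::euclidean_space \<Rightarrow> 'w"
  assumes lin: "linear L" "linear M" "linear K" "linear N"
    and "C_k k f" "C_k k g"
  shows "C_k k (\<lambda>p. L (f (M p)) + K (g (N p)))"
  using assms(5,6)
proof (induction k arbitrary: f g)
  case 0
  have linear_map: "continuous_on S T"
    if "linear T" for T :: "'s::euclidean_space \<Rightarrow> 't::real_normed_vector" and S
    using that by (simp add: linear_conv_bounded_linear linear_continuous_on)
  have sandwich: "continuous_on UNIV (\<lambda>p. T (F (R p)))"
    if "linear T" "linear R" "continuous_on UNIV F"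
    for T :: "'s::euclidean_space \<Rightarrow> 't::real_normed_vector"
      and R :: "'r::euclidean_space \<Rightarrow> 'q::real_normed_vector" and F
    by (rule continuous_on_compose2[OF linear_map[OF that(1)]
          continuous_on_compose2[OF that(3) linear_map[OF that(2)]]]) auto
  have "continuous_on UNIV (\<lambda>p. L (f (M p)))" "continuous_on UNIV (\<lambda>p. K (g (N p)))"
    using 0 by (simp_all add: sandwich lin)
  then show ?case
    by (simp add: continuous_on_add)
next
  case (Suc k)
  have diff: "\<And>p. f differentiable (at p)" "\<And>p. g differentiable (at p)"
    using Suc.prems by simp_all
  have "(\<lambda>p. L (f (M p)) + K (g (N p))) differentiable (at p)" for p
    using has_derivative_linear_sandwich_add[OF lin diff] by (rule differentiableI)
  moreover have "C_k k (dir_deriv w (\<lambda>p. L (f (M p)) + K (g (N p))))" for w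
    unfolding dir_deriv_linear_sandwich_add[OF lin diff]
    using Suc.prems by (intro Suc.IH) simp_all
  ultimately show ?case
    by simp
qed

lemma C_infinity_linear_sandwich_add:
  fixes M :: "'v::euclidean_space \<Rightarrow> 'v1::real_normed_vector"
    and N :: "'v \<Rightarrow> 'v2::real_normed_vector"
    and L :: "'w1::euclidean_space \<Rightarrow> 'w::real_normed_vector"
    and K :: "'w2::euclidean_space \<Rightarrow> 'w"
  assumes "linear L" "linear M" "linear K" "linear N" "C_infinity f" "C_infinity g"
  shows "C_infinity (\<lambda>p. L (f (M p)) + K (g (N p)))"
  using assms C_k_linear_sandwich_add unfolding C_infinity_def by blast

lemma C_infinity_differentiable:
  assumes "C_infinity f"
  shows "f differentiable (at p)"
proof -
  have "C_k (Suc 0) f"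
    using assms unfolding C_infinity_def by blast
  then show ?thesis
    by simp
qed

lemma C_infinity_dir_deriv:
  assumes "C_infinity f"
  shows "C_infinity (dir_deriv w f)"
  unfolding C_infinity_def
proof
  fix k
  have "C_k (Suc k) f"
    using assms unfolding C_infinity_def by blast
  then show "C_k k (dir_deriv w f)"
    by simp
qed

section \<open>The direct sum of two cross-free maps\<close>

text \<open>Coordinate directions outside the image of \<open>u\<close> or \<open>v\<close> are annihilated by
  \<open>restrict_pair u v\<close>, so the only second derivatives that survive in the sum are those of the
  rectangle \<open>range u \<times> range v\<close>, and there they are the mixed partials of \<open>h\<close>.\<close>

lemma sum_restricted_mixed_derivatives:
  fixes u :: "'a1::finite \<Rightarrow> 'a::finite" and v :: "'b1::finite \<Rightarrow> 'b::finite"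
    and h :: "'a1 torus \<times> 'b1 torus \<Rightarrow> real ^ ('a1 \<times> 'b1)"
  assumes inj: "inj u" "inj v" and smooth: "C_infinity (lift h)"
  shows "(\<Sum>(i, \<alpha>)\<in>UNIV. z $ (i, \<alpha>) *\<^sub>R
        dir_deriv (restrict_pair u v (axis i 1, 0))
          (dir_deriv (restrict_pair u v (0, axis \<alpha> 1)) (lift h)) q)
    = mixed_hessian h q (restrict_coords (map_prod u v) z)"
    (is "(\<Sum>(i, \<alpha>)\<in>UNIV. z $ (i, \<alpha>) *\<^sub>R ?D i \<alpha>) = _")
proof -
  have zero_direction: "dir_deriv 0 (lift h) = (\<lambda>_. 0)"
      "dir_deriv 0 (dir_deriv w (lift h)) = (\<lambda>_. 0)" for w
    using smooth
    by (intro dir_deriv_zero_direction C_infinity_differentiable C_infinity_dir_deriv; simp)+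
  have outside: "?D i \<alpha> = 0" if "(i, \<alpha>) \<notin> range (map_prod u v)" for i \<alpha>
  proof -
    have "i \<notin> range u \<or> \<alpha> \<notin> range v"
      using that by (metis map_prod_simp rangeE rangeI)
    then show ?thesis
      by (auto simp: restrict_pair_def restrict_coords_axis_outside restrict_coords_zero
          zero_direction dir_deriv_constant simp flip: zero_prod_def)
  qed
  have inside: "?D (u i) (v \<alpha>) = mixed_partial h i \<alpha> q" for i \<alpha>
    by (simp add: mixed_partial_def restrict_pair_def restrict_coords_axis inj restrict_coords_zero)
  have "(\<Sum>(i, \<alpha>)\<in>UNIV. z $ (i, \<alpha>) *\<^sub>R ?D i \<alpha>)
      = (\<Sum>(i, \<alpha>)\<in>range (map_prod u v). z $ (i, \<alpha>) *\<^sub>R ?D i \<alpha>)"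
    using outside by (intro sum.mono_neutral_right) auto
  also have "\<dots> = (\<Sum>(i, \<alpha>)\<in>UNIV. z $ (u i, v \<alpha>) *\<^sub>R ?D (u i) (v \<alpha>))"
    by (subst sum.reindex[OF prod.inj_map[OF inj]]) (simp add: case_prod_unfold map_prod_def)
  also have "\<dots> = mixed_hessian h q (restrict_coords (map_prod u v) z)"
    by (simp add: inside mixed_hessian_def restrict_coords_def)
  finally show ?thesis .
qed

definition direct_sum_map ::
  "('a1::finite \<Rightarrow> 'a::finite) \<Rightarrow> ('b1::finite \<Rightarrow> 'b::finite)
    \<Rightarrow> ('a2::finite \<Rightarrow> 'a) \<Rightarrow> ('b2::finite \<Rightarrow> 'b)
    \<Rightarrow> ('a1 torus \<times> 'b1 torus \<Rightarrow> real ^ ('a1 \<times> 'b1))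
    \<Rightarrow> ('a2 torus \<times> 'b2 torus \<Rightarrow> real ^ ('a2 \<times> 'b2))
    \<Rightarrow> 'a torus \<times> 'b torus \<Rightarrow> real ^ ('a \<times> 'b)" where
  "direct_sum_map u1 v1 u2 v2 h1 h2 = (\<lambda>(s, t).
      extend_by_zero (map_prod u1 v1) (h1 (torus_restrict u1 s, torus_restrict v1 t))
    + extend_by_zero (map_prod u2 v2) (h2 (torus_restrict u2 s, torus_restrict v2 t)))"

lemma lift_direct_sum_map:
  "lift (direct_sum_map u1 v1 u2 v2 h1 h2) = (\<lambda>p.
      extend_by_zero (map_prod u1 v1) (lift h1 (restrict_pair u1 v1 p))
    + extend_by_zero (map_prod u2 v2) (lift h2 (restrict_pair u2 v2 p)))"
  by (auto simp: lift_def direct_sum_map_def restrict_pair_def torus_restrict.abs_eq fun_eq_iff)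

lemma mixed_hessian_direct_sum:
  assumes inj: "inj u1" "inj v1" "inj u2" "inj v2"
    and smooth: "C_infinity (lift h1)" "C_infinity (lift h2)"
  shows "mixed_hessian (direct_sum_map u1 v1 u2 v2 h1 h2) p = (\<lambda>z.
      extend_by_zero (map_prod u1 v1)
        (mixed_hessian h1 (restrict_pair u1 v1 p) (restrict_coords (map_prod u1 v1) z))
    + extend_by_zero (map_prod u2 v2)
        (mixed_hessian h2 (restrict_pair u2 v2 p) (restrict_coords (map_prod u2 v2) z)))"
proof
  fix z
  note linear_maps = linear_extend_by_zero linear_restrict_pair linear_extend_by_zero
    linear_restrict_pair
  have partials: "mixed_partial (direct_sum_map u1 v1 u2 v2 h1 h2) i \<alpha> p =
      extend_by_zero (map_prod u1 v1)
        (dir_deriv (restrict_pair u1 v1 (axis i 1, 0))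
          (dir_deriv (restrict_pair u1 v1 (0, axis \<alpha> 1)) (lift h1)) (restrict_pair u1 v1 p))
    + extend_by_zero (map_prod u2 v2)
        (dir_deriv (restrict_pair u2 v2 (axis i 1, 0))
          (dir_deriv (restrict_pair u2 v2 (0, axis \<alpha> 1)) (lift h2)) (restrict_pair u2 v2 p))"
    (is "_ = extend_by_zero _ (?D1 i \<alpha>) + extend_by_zero _ (?D2 i \<alpha>)") for i \<alpha>
    using smooth
    by (simp add: mixed_partial_def lift_direct_sum_map
        dir_deriv_linear_sandwich_add[OF linear_maps] C_infinity_differentiable
        C_infinity_dir_deriv)
  have "mixed_hessian (direct_sum_map u1 v1 u2 v2 h1 h2) p z =
      extend_by_zero (map_prod u1 v1) (\<Sum>(i, \<alpha>)\<in>UNIV. z $ (i, \<alpha>) *\<^sub>R ?D1 i \<alpha>)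
    + extend_by_zero (map_prod u2 v2) (\<Sum>(i, \<alpha>)\<in>UNIV. z $ (i, \<alpha>) *\<^sub>R ?D2 i \<alpha>)"
    by (simp add: mixed_hessian_def partials case_prod_unfold scaleR_add_right sum.distrib
        linear_sum[OF linear_extend_by_zero] linear_cmul[OF linear_extend_by_zero])
  then show "mixed_hessian (direct_sum_map u1 v1 u2 v2 h1 h2) p z =
      extend_by_zero (map_prod u1 v1)
        (mixed_hessian h1 (restrict_pair u1 v1 p) (restrict_coords (map_prod u1 v1) z))
    + extend_by_zero (map_prod u2 v2)
        (mixed_hessian h2 (restrict_pair u2 v2 p) (restrict_coords (map_prod u2 v2) z))"
    by (simp only: sum_restricted_mixed_derivatives inj smooth)
qed

lemma cross_free_direct_sum:
  assumes inj: "inj u1" "inj v1" "inj u2" "inj v2"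
    and disjoint: "range (map_prod u1 v1) \<inter> range (map_prod u2 v2) = {}"
    and cover: "range (map_prod u1 v1) \<union> range (map_prod u2 v2) = UNIV"
    and "cross_free h1" "cross_free h2"
  shows "cross_free (direct_sum_map u1 v1 u2 v2 h1 h2)"
proof -
  have smooth: "C_infinity (lift h1)" "C_infinity (lift h2)"
    and bij: "\<And>q. bij (mixed_hessian h1 q)" "\<And>q. bij (mixed_hessian h2 q)"
    using assms(7,8) unfolding cross_free_def by blast+
  show ?thesis
    unfolding cross_free_def lift_direct_sum_map mixed_hessian_direct_sum[OF inj smooth]
    by (intro conjI allI bij_block_diagonal C_infinity_linear_sandwich_add linear_extend_by_zero
        linear_restrict_pair prod.inj_map inj smooth bij disjoint cover)
qed

lemma disjoint_union_injections:
  assumes "CARD('c::finite) = CARD('c1::finite) + CARD('c2::finite)"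
  obtains v1 :: "'c1::finite \<Rightarrow> 'c::finite" and v2 :: "'c2::finite \<Rightarrow> 'c"
  where "inj v1" "inj v2" "range v1 \<inter> range v2 = {}" "range v1 \<union> range v2 = UNIV"
proof -
  have "CARD('c1 + 'c2) = CARD('c)"
    using assms by simp
  then obtain f :: "'c1 + 'c2 \<Rightarrow> 'c" where f: "bij f"
    using finite_same_card_bij[of "UNIV :: ('c1 + 'c2) set" "UNIV :: 'c set"] by auto
  show thesis
  proof
    show "inj (f \<circ> Inl)" "inj (f \<circ> Inr)"
      using bij_is_inj[OF f] by (auto intro!: inj_compose)
    show "range (f \<circ> Inl) \<inter> range (f \<circ> Inr) = {}"
      using bij_is_inj[OF f] by (auto simp: inj_eq)
    have "range (f \<circ> Inl) \<union> range (f \<circ> Inr) = f ` (range Inl \<union> range Inr)"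
      by (simp add: image_Un image_comp)
    also have "range Inl \<union> range Inr = (UNIV :: ('c1 + 'c2) set)"
      by (simp add: UNIV_sum)
    finally show "range (f \<circ> Inl) \<union> range (f \<circ> Inr) = UNIV"
      using bij_is_surj[OF f] by simp
  qed
qed

lemma range_map_prod: "range (map_prod u v) = range u \<times> range v"
  by (metis UNIV_Times_UNIV map_prod_image)

theorem lemma5:
  "(CARD('b12::finite) = CARD('b1::finite) + CARD('b2::finite) \<longrightarrow>
      cross_free_maps TYPE('a::finite) TYPE('b1) \<noteq> {} \<longrightarrow>
      cross_free_maps TYPE('a) TYPE('b2) \<noteq> {} \<longrightarrow>
      cross_free_maps TYPE('a) TYPE('b12) \<noteq> {}) \<and>
   (CARD('a12::finite) = CARD('a1::finite) + CARD('a2::finite) \<longrightarrow>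
      cross_free_maps TYPE('a1) TYPE('b::finite) \<noteq> {} \<longrightarrow>
      cross_free_maps TYPE('a2) TYPE('b) \<noteq> {} \<longrightarrow>
      cross_free_maps TYPE('a12) TYPE('b) \<noteq> {})"
proof (intro conjI impI)
  assume card: "CARD('b12) = CARD('b1) + CARD('b2)"
    and "cross_free_maps TYPE('a) TYPE('b1) \<noteq> {}" "cross_free_maps TYPE('a) TYPE('b2) \<noteq> {}"
  then obtain h1 :: "'a torus \<times> 'b1 torus \<Rightarrow> real ^ ('a \<times> 'b1)"
    and h2 :: "'a torus \<times> 'b2 torus \<Rightarrow> real ^ ('a \<times> 'b2)"
    where h: "cross_free h1" "cross_free h2"
    unfolding cross_free_maps_def by blast
  obtain v1 :: "'b1 \<Rightarrow> 'b12" and v2 :: "'b2 \<Rightarrow> 'b12"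
    where v: "inj v1" "inj v2" "range v1 \<inter> range v2 = {}" "range v1 \<union> range v2 = UNIV"
    using disjoint_union_injections[OF card] .
  have "cross_free (direct_sum_map id v1 id v2 h1 h2)"
    using v(3,4)
    by (intro cross_free_direct_sum h inj_on_id v(1,2)) (auto simp: range_map_prod)
  then show "cross_free_maps TYPE('a) TYPE('b12) \<noteq> {}"
    unfolding cross_free_maps_def by blast
next
  assume card: "CARD('a12) = CARD('a1) + CARD('a2)"
    and "cross_free_maps TYPE('a1) TYPE('b) \<noteq> {}" "cross_free_maps TYPE('a2) TYPE('b) \<noteq> {}"
  then obtain h1 :: "'a1 torus \<times> 'b torus \<Rightarrow> real ^ ('a1 \<times> 'b)"
    and h2 :: "'a2 torus \<times> 'b torus \<Rightarrow> real ^ ('a2 \<times> 'b)"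
    where h: "cross_free h1" "cross_free h2"
    unfolding cross_free_maps_def by blast
  obtain u1 :: "'a1 \<Rightarrow> 'a12" and u2 :: "'a2 \<Rightarrow> 'a12"
    where u: "inj u1" "inj u2" "range u1 \<inter> range u2 = {}" "range u1 \<union> range u2 = UNIV"
    using disjoint_union_injections[OF card] .
  have "cross_free (direct_sum_map u1 id u2 id h1 h2)"
    using u(3,4)
    by (intro cross_free_direct_sum h inj_on_id u(1,2)) (auto simp: range_map_prod)
  then show "cross_free_maps TYPE('a12) TYPE('b) \<noteq> {}"
    unfolding cross_free_maps_def by blast
qed

end
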